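(* Let $\Sigma=(X,\mathcal U,\phi)$ be a forward complete control system with input space $\mathcal U=L^\infty(\mathbb R_+,U)$ which has the CEP and BRS properties. If there exists a (possibly non-coercive) ISS Lyapunov function for $\Sigma$, then $\Sigma$ is ISS.
   Context: Let $X$, $U$ be Banach spaces. A forward complete control system is a triple $\Sigma=(X,\mathcal U,\phi)$ with $\phi:\mathbb R_+\times X\times\mathcal U\to X$ such that: $\phi(0,x,u)=x$; (causality) $\phi(t,x,u)=\phi(t,x,\tilde u)$ whenever $u|_{[0,t]}=\tilde u|_{[0,t]}$; for each $(x,u)$ the map $t\mapsto\phi(t,x,u)$ is continuous; (cocycle) $\phi(h,\phi(t,x,u),u(t+\cdot))=\phi(t+h,x,u)$ for all $t,h\ge0$, $x\in X$, $u\in\mathcal U$. Comparison functions: $\mathcal K$ = continuous strictly increasing $\gamma:\mathbb R_+\to\mathbb R_+$ with $\gamma(0)=0$; $\mathcal K_\infty$ = unbounded functions in $\mathcal K$; $\mathcal{KL}$ = $\beta:\mathbb R_+^2\to\mathbb R_+$ with $\beta(\cdot,t)\in\mathcal K$ and $\beta(r,\cdot)$ continuous strictly decreasing with limit $0$ for $r>0$. CEP: $\phi(t,0,0)=0$ for all $t\ge0$ and for every $\varepsilon>0$, $h>0$ there is $\delta>0$ such that $t\in[0,h]$, $\|x\|_X\le\delta$, $\|u\|_{\mathcal U}\le\delta$ imply $\|\phi(t,x,u)\|_X\le\varepsilon$. BRS: for all $C,\tau>0$, $\sup\{\|\phi(t,x,u)\|_X:\|x\|_X\le C,\|u\|_{\mathcal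 U}\le C,t\in[0,\tau]\}<\infty$. ISS: there are $\beta\in\mathcal{KL}$, $\gamma\in\mathcal K$ with $\|\phi(t,x,u)\|_X\le\beta(\|x\|_X,t)+\gamma(\|u\|_{\mathcal U})$ for all $x,u,t\ge0$. Dini derivative along trajectories: $\dot V_u(x)=\limsup_{t\to+0}\frac1t(V(\phi(t,x,u))-V(x))$. A continuous $V:X\to\mathbb R_+$ is a non-coercive ISS Lyapunov function for $\Sigma$ if there exist $\psi_2,\alpha\in\mathcal K_\infty$, $\sigma\in\mathcal K$ with $0<V(x)\le\psi_2(\|x\|_X)$ for all $x\ne0$ and $\dot V_u(x)\le-\alpha(\|x\|_X)+\sigma(\|u\|_{\mathcal U})$ for all $x\in X$, $u\in\mathcal U$. *)

theory Defs
  imports "HOL-Analysis.Analysis"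
begin

text \<open>Inputs are represented by functions real => 'u; only their values on [0,inf) matter.
  The input space consists of the Lebesgue measurable, essentially bounded (on [0,inf)) functions.
  Elements of L^infinity are a.e.-classes; this is reflected by requiring the flow to be
  insensitive to a.e. modifications of the input (see the causality axiom).\<close>

definition Linf_inputs :: "(real \<Rightarrow> 'u::banach) set" where
  "Linf_inputs = {u. u \<in> borel_measurable (restrict_space lebesgue {0..}) \<and>
      (\<exists>C. AE s in lebesgue. 0 \<le> s \<longrightarrow> norm (u s) \<le> C)}"

definition linf_norm :: "(real \<Rightarrow> 'u::banach) \<Rightarrow> real" where
  "linf_norm u = Inf {C. 0 \<le> C \<and> (AE s in lebesgue. 0 \<le> s \<longrightarrow> norm (u s) \<le> C)}"

definition forward_complete_control_system ::
  "(real \<Rightarrow> 'x::banach \<Rightarrow> (real \<Rightarrow> 'u::banach) \<Rightarrow> 'x) \<Rightarrow> bool" where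
  "forward_complete_control_system \<phi> \<longleftrightarrow>
     (\<forall>x. \<forall>u\<in>Linf_inputs. \<phi> 0 x u = x) \<and>
     (\<forall>t\<ge>0. \<forall>x. \<forall>u\<in>Linf_inputs. \<forall>v\<in>Linf_inputs.
        (AE s in lebesgue. s \<in> {0..t} \<longrightarrow> u s = v s) \<longrightarrow> \<phi> t x u = \<phi> t x v) \<and>
     (\<forall>x. \<forall>u\<in>Linf_inputs. continuous_on {0..} (\<lambda>t. \<phi> t x u)) \<and>
     (\<forall>t\<ge>0. \<forall>h\<ge>0. \<forall>x. \<forall>u\<in>Linf_inputs.
        \<phi> h (\<phi> t x u) (\<lambda>s. u (t + s)) = \<phi> (t + h) x u)"

definition class_K :: "(real \<Rightarrow> real) \<Rightarrow> bool" where
  "class_K \<gamma> \<longleftrightarrow> continuous_on {0..} \<gamma> \<and> \<gamma> 0 = 0 \<and>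
     (\<forall>r s. 0 \<le> r \<longrightarrow> r < s \<longrightarrow> \<gamma> r < \<gamma> s)"

definition class_Kinf :: "(real \<Rightarrow> real) \<Rightarrow> bool" where
  "class_Kinf \<gamma> \<longleftrightarrow> class_K \<gamma> \<and> (\<forall>M. \<exists>r\<ge>0. \<gamma> r > M)"

definition class_KL :: "(real \<Rightarrow> real \<Rightarrow> real) \<Rightarrow> bool" where
  "class_KL \<beta> \<longleftrightarrow>
     (\<forall>t\<ge>0. class_K (\<lambda>r. \<beta> r t)) \<and>
     (\<forall>r>0. continuous_on {0..} (\<beta> r) \<and>
        (\<forall>s t. 0 \<le> s \<longrightarrow> s < t \<longrightarrow> \<beta> r t < \<beta> r s) \<and>
        (\<beta> r \<longlongrightarrow> 0) at_top)"

definition CEP :: "(real \<Rightarrow> 'x::banach \<Rightarrow> (real \<Rightarrow> 'u::banach) \<Rightarrow> 'x) \<Rightarrow> bool" where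
  "CEP \<phi> \<longleftrightarrow> (\<forall>t\<ge>0. \<phi> t 0 (\<lambda>_. 0) = 0) \<and>
     (\<forall>\<epsilon>>0. \<forall>h>0. \<exists>\<delta>>0. \<forall>t x. \<forall>u\<in>Linf_inputs.
        t \<in> {0..h} \<longrightarrow> norm x \<le> \<delta> \<longrightarrow> linf_norm u \<le> \<delta> \<longrightarrow> norm (\<phi> t x u) \<le> \<epsilon>)"

definition BRS :: "(real \<Rightarrow> 'x::banach \<Rightarrow> (real \<Rightarrow> 'u::banach) \<Rightarrow> 'x) \<Rightarrow> bool" where
  "BRS \<phi> \<longleftrightarrow> (\<forall>C>0. \<forall>\<tau>>0. bdd_above
     {norm (\<phi> t x u) | t x u. u \<in> Linf_inputs \<and> norm x \<le> C \<and> linf_norm u \<le> C \<and> t \<in> {0..\<tau>}})"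

definition ISS :: "(real \<Rightarrow> 'x::banach \<Rightarrow> (real \<Rightarrow> 'u::banach) \<Rightarrow> 'x) \<Rightarrow> bool" where
  "ISS \<phi> \<longleftrightarrow> (\<exists>\<beta> \<gamma>. class_KL \<beta> \<and> class_K \<gamma> \<and>
     (\<forall>x. \<forall>u\<in>Linf_inputs. \<forall>t\<ge>0.
        norm (\<phi> t x u) \<le> \<beta> (norm x) t + \<gamma> (linf_norm u)))"

definition dini_derivative ::
  "('x::banach \<Rightarrow> real) \<Rightarrow> (real \<Rightarrow> 'x \<Rightarrow> (real \<Rightarrow> 'u::banach) \<Rightarrow> 'x) \<Rightarrow> 'x \<Rightarrow> (real \<Rightarrow> 'u) \<Rightarrow> ereal" where
  "dini_derivative V \<phi> x u = Limsup (at_right 0) (\<lambda>t. ereal ((V (\<phi> t x u) - V x) / t))"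

definition noncoercive_ISS_Lyapunov ::
  "('x::banach \<Rightarrow> real) \<Rightarrow> (real \<Rightarrow> 'x \<Rightarrow> (real \<Rightarrow> 'u::banach) \<Rightarrow> 'x) \<Rightarrow> bool" where
  "noncoercive_ISS_Lyapunov V \<phi> \<longleftrightarrow> continuous_on UNIV V \<and> (\<forall>x. 0 \<le> V x) \<and>
     (\<exists>\<psi>\<^sub>2 \<alpha> \<sigma>. class_Kinf \<psi>\<^sub>2 \<and> class_Kinf \<alpha> \<and> class_K \<sigma> \<and>
       (\<forall>x. x \<noteq> 0 \<longrightarrow> 0 < V x \<and> V x \<le> \<psi>\<^sub>2 (norm x)) \<and>
       (\<forall>x. \<forall>u\<in>Linf_inputs.
          dini_derivative V \<phi> x u \<le> ereal (- \<alpha> (norm x) + \<sigma> (linf_norm u))))"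

end

theory Submission
  imports Defs
begin

text \<open>As long as a trajectory stays above a level that dominates the gain of the input, \<open>V\<close> decreases at a
  fixed rate along it; since \<open>V \<ge> 0\<close>, the time spent there is bounded by the value of \<open>V\<close> at the start.
  Following a trajectory from its last visit to such a level, this bound and BRS give uniform boundedness
  of all trajectories, while this bound and CEP give uniform stability. Together they yield
  \<open>norm (\<phi> t x u) \<le> \<kappa> (max (norm x) (linf_norm u))\<close> for a class K function \<open>\<kappa>\<close>. The same time bound shows
  that every trajectory from a ball enters a neighbourhood of 0 of the size of the gain within a
  uniform time, and by the previous estimate it stays in a comparable one. The excess of
  \<open>norm (\<phi> t x u)\<close> over a gain of the input is thus uniformly bounded, small for small \<open>x\<close> and uniformly
  decaying, and such a quantity has a class KL majorant.\<close>

subsection \<open>Real functions with bounded Dini derivative\<close>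

text \<open>The time \<open>s\<close> is the supremum of the times with \<open>g \<le> C\<close>,
  where the intermediate value theorem excludes \<open>g s < C\<close>, or \<open>a\<close> if
  \<open>g\<close> never drops below \<open>C\<close>; the \<open>max\<close> covers both cases.
  Restarting a trajectory at \<open>s\<close> combines an upper bound at the start with a lower
  bound from then on.\<close>

lemma last_time_at_level:
  fixes g :: "real \<Rightarrow> real"
  assumes cont: "continuous_on {a..b} g" and "a \<le> b" and "C \<le> g b"
  shows "\<exists>s\<in>{a..b}. g s \<le> max C (g a) \<and> (\<forall>r\<in>{s..b}. C \<le> g r)"
proof (cases "\<forall>r\<in>{a..b}. C \<le> g r")
  case True
  then show ?thesis using \<open>a \<le> b\<close> by (intro bexI[of _ a]) auto
next
  case False
  define Z where "Z = {r\<in>{a..b}. g r \<le> C}"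
  have "Z = {a..b} \<inter> g -` {..C}" by (auto simp: Z_def)
  then have "closed Z" using continuous_closed_preimage[OF cont] by simp
  moreover have "Z \<noteq> {}" using False by (auto simp: Z_def)
  moreover have bdd: "bdd_above Z" by (rule bdd_aboveI[of _ b]) (simp add: Z_def)
  ultimately have SZ: "Sup Z \<in> Z" by (intro closed_contains_Sup)
  define s where "s = Sup Z"
  have s: "s \<in> {a..b}" "g s \<le> C" using SZ by (auto simp: s_def Z_def)
  have after: "C < g r" if "s < r" "r \<le> b" for r
  proof (rule ccontr)
    assume "\<not> C < g r"
    then have "r \<in> Z" using that s by (auto simp: Z_def)
    then have "r \<le> s" unfolding s_def using bdd by (rule cSup_upper)
    then show False using that by simp
  qed
  have "C \<le> g s"
  proof (rule ccontr)
    assume less: "\<not> C \<le> g s"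
    obtain r where r: "s \<le> r" "r \<le> b" "g r = C"
      using IVT'[of g s C b] less \<open>C \<le> g b\<close> s continuous_on_subset[OF cont, of "{s..b}"] by force
    then have "s \<noteq> r" using less by auto
    then show False using after[of r] r by simp
  qed
  then show ?thesis using s after
    by (intro bexI[of _ s]) (auto simp: le_less)
qed

text \<open>If the estimate failed, a tilted copy \<open>k\<close> of \<open>g\<close> would vanish
  at \<open>a\<close> and be positive at \<open>b\<close>. From its last time \<open>s\<close> at
  level 0 on, \<open>k\<close> is nonnegative, whereas the Dini bound at \<open>s\<close> yields a
  point just after \<open>s\<close> where \<open>k\<close> is smaller than
  \<open>k s \<le> 0\<close>.\<close>

lemma decrease_if_Dini_derivative_le:
  fixes g :: "real \<Rightarrow> real"
  assumes cont: "continuous_on {a..b} g" and "a \<le> b"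
    and dini: "\<And>s. a \<le> s \<Longrightarrow> s < b \<Longrightarrow>
      Limsup (at_right 0) (\<lambda>h. ereal ((g (s + h) - g s) / h)) \<le> ereal (- c)"
  shows "g b \<le> g a - c * (b - a)"
proof (rule ccontr)
  assume neg: "\<not> g b \<le> g a - c * (b - a)"
  then have "a < b" using \<open>a \<le> b\<close> by (cases "a = b") auto
  \<comment> \<open>Half of the excess slope is spent on a strict inequality for the Dini
    derivative; the other half keeps \<open>k b\<close> positive.\<close>
  define e where "e = (g b - g a + c * (b - a)) / (2 * (b - a))"
  have e: "0 < e" "2 * (e * (b - a)) = g b - g a + c * (b - a)"
    using neg \<open>a < b\<close> by (auto simp: e_def field_simps)
  define k where "k s = g s - g a + (c - e) * (s - a)" for s
  have "k b = e * (b - a)" using e(2) by (simp add: k_def algebra_simps)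
  then have kb: "0 < k b" using e(1) \<open>a < b\<close> by simp
  have "continuous_on {a..b} k" unfolding k_def by (intro continuous_intros cont)
  from last_time_at_level[OF this \<open>a \<le> b\<close>, of 0] kb
  obtain s where s: "s \<in> {a..b}" "k s \<le> 0" "\<forall>r\<in>{s..b}. 0 \<le> k r"
    by (auto simp: k_def)
  then have "s < b" using kb by (cases "s = b") auto
  have "Limsup (at_right 0) (\<lambda>h. ereal ((g (s + h) - g s) / h)) < ereal (- c + e)"
    using dini[of s] s \<open>s < b\<close> e by (simp add: order.strict_trans1)
  from Limsup_lessD[OF this]
  have "eventually (\<lambda>h. (g (s + h) - g s) / h < - c + e) (at_right 0)" by simp
  moreover have "eventually (\<lambda>h. h \<in> {0<..<b - s}) (at_right (0::real))"
    using \<open>s < b\<close> by (intro eventually_at_right_real) auto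
  ultimately have "eventually (\<lambda>h. (g (s + h) - g s) / h < - c + e \<and> h \<in> {0<..<b - s}) (at_right 0)"
    by (rule eventually_conj)
  from eventually_happens'[OF _ this] obtain h
    where h: "(g (s + h) - g s) / h < - c + e" "0 < h" "h < b - s" by auto
  then have "g (s + h) - g s < (- c + e) * h" by (simp add: field_simps)
  then have "k (s + h) < k s" by (simp add: k_def algebra_simps)
  moreover have "0 \<le> k (s + h)" using s h by auto
  ultimately show False using s by simp
qed

subsection \<open>Comparison functions\<close>

lemma class_K_strict_mono:
  "class_K f \<Longrightarrow> 0 \<le> r \<Longrightarrow> r < s \<Longrightarrow> f r < f s"
  by (simp add: class_K_def)

lemma class_K_mono:
  "class_K f \<Longrightarrow> 0 \<le> r \<Longrightarrow> r \<le> s \<Longrightarrow> f r \<le> f s"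
  using class_K_strict_mono[of f r s] by (cases "r = s") auto

lemma class_K_nonneg:
  "class_K f \<Longrightarrow> 0 \<le> r \<Longrightarrow> 0 \<le> f r"
  using class_K_mono[of f 0 r] by (simp add: class_K_def)

lemma class_K_pos:
  "class_K f \<Longrightarrow> 0 < r \<Longrightarrow> 0 < f r"
  using class_K_strict_mono[of f 0 r] by (simp add: class_K_def)

lemma class_K_small:
  assumes "class_K f" "0 < e"
  shows "\<exists>d>0. f d \<le> e"
proof -
  have "continuous_on {0..} f" "f 0 = 0" using assms by (auto simp: class_K_def)
  then obtain d where d: "d > 0" "\<And>r. r \<ge> 0 \<Longrightarrow> dist r 0 < d \<Longrightarrow> dist (f r) 0 < e"
    unfolding continuous_on_iff using \<open>0 < e\<close> by (metis atLeast_iff order_refl)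
  from d(2)[of "d/2"] d(1) show ?thesis by (intro exI[of _ "d/2"]) auto
qed

lemma class_K_add:
  "class_K f \<Longrightarrow> class_K g \<Longrightarrow> class_K (\<lambda>r. f r + g r)"
  unfolding class_K_def by (auto intro!: continuous_intros add_strict_mono)

lemma class_K_compose:
  assumes "class_K f" "class_K g"
  shows "class_K (\<lambda>r. f (g r))"
  unfolding class_K_def
proof (intro conjI allI impI)
  have "continuous_on {0..} f" "continuous_on {0..} g" using assms by (auto simp: class_K_def)
  then show "continuous_on {0..} (\<lambda>r. f (g r))"
    by (rule continuous_on_compose2) (auto intro: class_K_nonneg[OF assms(2)])
  show "f (g 0) = 0" using assms by (simp add: class_K_def)
  show "f (g r) < f (g s)" if "0 \<le> r" "r < s" for r s
    using that by (intro class_K_strict_mono[OF assms(1)] class_K_strict_mono[OF assms(2)]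
        class_K_nonneg[OF assms(2)]) auto
qed

lemma class_K_scaled_ident: "0 < c \<Longrightarrow> class_K (\<lambda>r. c * r)"
  unfolding class_K_def by (auto intro!: continuous_intros)

text \<open>The majorant is a supremum over the given points \<open>(q, s, y)\<close> of \<open>y\<close> times a weight, which decays like
  \<open>exp (- (t - s))\<close> after time \<open>s\<close> and grows from 0 to 1 as \<open>r\<close> runs from \<open>q / 2\<close> to \<open>q\<close>. The weights
  are locally equi-Lipschitz, so continuity survives the supremum.\<close>

lemma KL_majorant:
  fixes P :: "real \<Rightarrow> real \<Rightarrow> real \<Rightarrow> bool"
  assumes bounded: "\<And>R. \<exists>M. \<forall>r t y. P r t y \<longrightarrow> 0 \<le> r \<longrightarrow> r \<le> R \<longrightarrow> 0 \<le> t \<longrightarrow> y \<le> M"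
    and small: "\<And>e. 0 < e \<Longrightarrow> \<exists>d>0. \<forall>r t y. P r t y \<longrightarrow> 0 \<le> r \<longrightarrow> r \<le> d \<longrightarrow> 0 \<le> t \<longrightarrow> y \<le> e"
    and decay: "\<And>R e. 0 < e \<Longrightarrow> \<exists>T\<ge>0. \<forall>r t y. P r t y \<longrightarrow> 0 \<le> r \<longrightarrow> r \<le> R \<longrightarrow> T \<le> t \<longrightarrow> y \<le> e"
  shows "\<exists>\<beta>. class_KL \<beta> \<and> (\<forall>r t y. P r t y \<longrightarrow> 0 \<le> r \<longrightarrow> 0 \<le> t \<longrightarrow> y \<le> \<beta> r t)"
proof -
  \<comment> \<open>For \<open>r > 0\<close> the condition \<open>q \<le> 2 * r\<close> keeps
    exactly the points whose weight at \<open>r\<close> is nonnegative. At \<open>r = 0\<close> only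
    \<open>q = 0\<close> remains, and since \<open>q / 0 = 0\<close> the weight does not vanish
    there; \<open>B 0 t = 0\<close> therefore has to come from \<open>small\<close>.\<close>
  define Q where "Q r q s y \<longleftrightarrow> P q s y \<and> 0 \<le> q \<and> q \<le> 2 * r \<and> 0 \<le> s \<and> 0 \<le> y" for r q s y
  define w where "w r t q s = exp (- max 0 (t - s)) * min 1 (2 - q / r)" for r t q s :: real
  \<comment> \<open>The inserted 0 keeps the set nonempty and its supremum nonnegative.\<close>
  define A where "A r t = insert 0 {y * w r t q s | q s y. Q r q s y}" for r t
  define B where "B r t = Sup (A r t)" for r t
  obtain M0 where M0: "\<And>R r t y. P r t y \<Longrightarrow> 0 \<le> r \<Longrightarrow> r \<le> R \<Longrightarrow> 0 \<le> t \<Longrightarrow> y \<le> M0 R"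
    using bounded by metis
  define M where "M R = max 0 (M0 R)" for R
  have M: "y \<le> M R" if "P r t y" "0 \<le> r" "r \<le> R" "0 \<le> t" for r t y R
    using M0[OF that] by (simp add: M_def)
  have M_nonneg: "0 \<le> M R" for R by (simp add: M_def)
  have w: "0 \<le> w r t q s" "w r t q s \<le> 1" if "0 \<le> r" "0 \<le> q" "q \<le> 2 * r" for r t q s
  proof -
    have "q / r \<le> 2" using that by (cases "r = 0") (auto simp: field_simps)
    then show "0 \<le> w r t q s" "w r t q s \<le> 1"
      unfolding w_def by (auto intro!: mult_le_one)
  qed
  have B_le: "B r t \<le> K" if "0 \<le> K" "\<And>q s y. Q r q s y \<Longrightarrow> y * w r t q s \<le> K" for r t K
    unfolding B_def A_def by (rule cSup_least) (use that in auto)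
  have term_le: "y * w r t q s \<le> y" if "Q r q s y" "0 \<le> r" for r t q s y
    using that w[of r q] by (intro mult_left_le) (auto simp: Q_def)
  have bdd: "bdd_above (A r t)" if "0 \<le> r" for r t
  proof (rule bdd_aboveI[of _ "M (2 * r)"])
    fix z assume "z \<in> A r t"
    then show "z \<le> M (2 * r)"
      using order_trans[OF term_le[OF _ that] M] M_nonneg unfolding A_def Q_def by blast
  qed
  have B_ge: "y * w r t q s \<le> B r t" if "Q r q s y" "0 \<le> r" for r t q s y
    unfolding B_def by (rule cSup_upper) (use that bdd in \<open>auto simp: A_def\<close>)
  have B_nonneg: "0 \<le> B r t" if "0 \<le> r" for r t
    unfolding B_def by (rule cSup_upper) (use that bdd in \<open>auto simp: A_def\<close>)
  have B_bound: "B r t \<le> e" if "0 \<le> r" "0 \<le> e" "\<And>q s y. Q r q s y \<Longrightarrow> y \<le> e" for r t e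
    using that by (intro B_le) (auto intro: order_trans[OF term_le])
  have B_M: "B r t \<le> M (2 * r)" if "0 \<le> r" for r t
    using that M_nonneg by (intro B_bound) (auto simp: Q_def intro: M)
  have B_small: "\<exists>d>0. \<forall>r t. 0 \<le> r \<longrightarrow> r \<le> d \<longrightarrow> B r t \<le> e" if e: "0 < e" for e
  proof -
    obtain d where "d > 0" "\<forall>r t y. P r t y \<longrightarrow> 0 \<le> r \<longrightarrow> r \<le> d \<longrightarrow> 0 \<le> t \<longrightarrow> y \<le> e"
      using small[OF e] by blast
    then show ?thesis
      using that by (intro exI[of _ "d / 2"]) (auto intro!: B_bound simp: Q_def)
  qed
  have B_0: "B 0 t = 0" for t
  proof (rule antisym)
    show "B 0 t \<le> 0"
    proof (rule field_le_epsilon)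
      fix e :: real assume "0 < e"
      then show "B 0 t \<le> 0 + e" using B_small by (metis add_0 less_imp_le order_refl)
    qed
  qed (simp add: B_nonneg)
  have w_mono: "w r t q s \<le> w r' t q s" if "0 < r" "r \<le> r'" "0 \<le> q" for r r' t q s
    unfolding w_def using that by (intro mult_left_mono min.mono) (auto simp: frac_le)
  have B_mono: "B r t \<le> B r' t" if "0 < r" "r \<le> r'" for r r' t
  proof (rule B_le)
    fix q s y assume "Q r q s y"
    then have Q: "Q r' q s y" "0 \<le> q" "0 \<le> y" using that by (auto simp: Q_def)
    then have "y * w r t q s \<le> y * w r' t q s"
      using that by (intro mult_left_mono w_mono) auto
    also have "\<dots> \<le> B r' t" using Q that by (intro B_ge) auto
    finally show "y * w r t q s \<le> B r' t" .
  qed (use B_nonneg that in auto)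
  \<comment> \<open>Passing from \<open>r\<close> to \<open>r'\<close> raises a weight by at most
    \<open>q / r - q / r' \<le> 2 * (r' - r) / r\<close>. Points with \<open>2 * r < q\<close> do
    not enter \<open>B r t\<close>; truncating their weight at \<open>r\<close> to 0 brings them
    under the same estimate.\<close>
  have B_lip: "B r' t \<le> B r t + M (2 * R) * (2 * (r' - r) / r)" if "0 < r" "r \<le> r'" "r' \<le> R" for r r' t R
  proof (rule B_le)
    fix q s y assume Q': "Q r' q s y"
    then have q: "0 \<le> q" "q \<le> 2 * r'" "0 \<le> y" "y \<le> M (2 * R)"
      using that by (auto simp: Q_def intro!: M)
    have "q / r - q / r' = q * ((r' - r) / (r * r'))" using that by (simp add: field_simps)
    also have "\<dots> \<le> (2 * r') * ((r' - r) / (r * r'))"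
      using that q by (intro mult_right_mono) auto
    also have "\<dots> = 2 * (r' - r) / r" using that by (simp add: field_simps)
    finally have diff: "q / r - q / r' \<le> 2 * (r' - r) / r" .
    define E where "E = exp (- max 0 (t - s))"
    have E: "0 \<le> E" "E \<le> 1" by (auto simp: E_def)
    have D: "0 \<le> 2 * (r' - r) / r" using that by simp
    have "y * w r' t q s \<le> y * (E * max 0 (min 1 (2 - q / r)) + 2 * (r' - r) / r)"
    proof (rule mult_left_mono)
      have "q / r' \<le> 2" using q that by (simp add: field_simps)
      then have "min 1 (2 - q / r') \<le> max 0 (min 1 (2 - q / r)) + 2 * (r' - r) / r"
        using diff D by linarith
      then have "E * min 1 (2 - q / r') \<le> E * (max 0 (min 1 (2 - q / r)) + 2 * (r' - r) / r)"
        using E by (intro mult_left_mono)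
      also have "\<dots> \<le> E * max 0 (min 1 (2 - q / r)) + 2 * (r' - r) / r"
        using E D by (simp add: distrib_left mult_left_le_one_le del: times_divide_eq_right)
      finally show "w r' t q s \<le> E * max 0 (min 1 (2 - q / r)) + 2 * (r' - r) / r"
        by (simp add: w_def E_def)
    qed (use q in auto)
    also have "\<dots> = y * (E * max 0 (min 1 (2 - q / r))) + y * (2 * (r' - r) / r)"
      by (simp add: algebra_simps)
    also have "\<dots> \<le> B r t + M (2 * R) * (2 * (r' - r) / r)"
    proof (rule add_mono)
      show "y * (2 * (r' - r) / r) \<le> M (2 * R) * (2 * (r' - r) / r)"
        using q D by (intro mult_right_mono) auto
      show "y * (E * max 0 (min 1 (2 - q / r))) \<le> B r t"
      proof (cases "q \<le> 2 * r")
        case True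
        then have "max 0 (min 1 (2 - q / r)) = min 1 (2 - q / r)"
          using that by (simp add: field_simps max_def)
        moreover have "Q r q s y" using Q' True by (simp add: Q_def)
        ultimately show ?thesis using B_ge[of r q s y t] that by (simp add: w_def E_def)
      next
        case False
        then have "2 - q / r \<le> 0" using that by (simp add: field_simps)
        then have "max 0 (min 1 (2 - q / r)) = 0" by linarith
        then show ?thesis using B_nonneg that by simp
      qed
    qed
    finally show "y * w r' t q s \<le> B r t + M (2 * R) * (2 * (r' - r) / r)" .
  qed (use B_nonneg M_nonneg that in auto)
  have B_cont_r: "continuous_on {0..} (\<lambda>r. B r t)" for t
    unfolding continuous_on_eq_continuous_within continuous_within
  proof
    fix r0 :: real assume "r0 \<in> {0..}"
    then consider "r0 = 0" | "0 < r0" by force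
    then show "((\<lambda>r. B r t) \<longlongrightarrow> B r0 t) (at r0 within {0..})"
    proof cases
      \<comment> \<open>The Lipschitz constant of \<open>B_lip\<close> blows up at 0, so continuity
        there comes from \<open>B_small\<close>.\<close>
      case 1
      show ?thesis unfolding tendsto_iff eventually_at
      proof (intro allI impI)
        fix e :: real assume "0 < e"
        then obtain d where d: "d > 0" "\<forall>r t. 0 \<le> r \<longrightarrow> r \<le> d \<longrightarrow> B r t \<le> e / 2"
          using B_small[of "e / 2"] by auto
        have "dist (B r t) (B r0 t) < e" if "0 \<le> r" "dist r r0 < d" for r
        proof -
          have "B r t \<le> e / 2" using d that 1 by auto
          then show ?thesis using B_nonneg[OF that(1), of t] \<open>0 < e\<close> by (simp add: 1 B_0)
        qed
        then show "\<exists>d>0. \<forall>x\<in>{0..}. x \<noteq> r0 \<and> dist x r0 < d \<longrightarrow> dist (B x t) (B r0 t) < e"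
          using d by auto
      qed
    next
      case 2
      \<comment> \<open>On \<open>r0 / 2 \<le> r\<close> the quotient
        \<open>2 * (r' - r) / r\<close> is at most \<open>4 / r0 * (r' - r)\<close>, and
        \<open>M\<close> is taken at twice the right end \<open>2 * r0\<close>.\<close>
      define L where "L = M (2 * (2 * r0)) * (4 / r0)"
      have lip: "B r' t - B r t \<le> L * (r' - r)" if "r0 / 2 \<le> r" "r \<le> r'" "r' \<le> 2 * r0" for r r'
      proof -
        have "2 * (r' - r) / r \<le> 2 * (r' - r) / (r0 / 2)"
          using that 2 by (intro divide_left_mono) auto
        then have "M (2 * (2 * r0)) * (2 * (r' - r) / r) \<le> M (2 * (2 * r0)) * (2 * (r' - r) / (r0 / 2))"
          using M_nonneg by (intro mult_left_mono)
        moreover have "\<dots> = L * (r' - r)" by (simp add: L_def)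
        ultimately show ?thesis using B_lip[of r r' "2 * r0" t] that 2 by simp
      qed
      have "eventually (\<lambda>r. r \<in> {r0 / 2<..<2 * r0}) (at r0 within {0..})"
        unfolding eventually_at_topological using 2
        by (intro exI[of _ "{r0 / 2<..<2 * r0}"]) auto
      then have "eventually (\<lambda>r. norm (B r t - B r0 t) \<le> L * \<bar>r - r0\<bar>) (at r0 within {0..})"
      proof eventually_elim
        case (elim r)
        then show ?case
          using lip[of r r0] lip[of r0 r] B_mono[of r r0 t] B_mono[of r0 r t] 2
          by (cases "r \<le> r0") auto
      qed
      moreover have "((\<lambda>r. L * \<bar>r - r0\<bar>) \<longlongrightarrow> 0) (at r0 within {0..})"
        by (auto intro!: tendsto_eq_intros)
      ultimately have "((\<lambda>r. B r t - B r0 t) \<longlongrightarrow> 0) (at r0 within {0..})"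
        by (rule Lim_null_comparison)
      then show ?thesis by (rule LIM_zero_cancel)
    qed
  qed
  have B_antimono: "B r t' \<le> B r t" if "0 \<le> r" "t \<le> t'" for r t t'
  proof (rule B_le)
    fix q s y assume Q: "Q r q s y"
    then have "q / r \<le> 2" using that by (cases "r = 0") (auto simp: field_simps Q_def)
    then have "w r t' q s \<le> w r t q s" unfolding w_def
      using that by (intro mult_right_mono) auto
    then have "y * w r t' q s \<le> y * w r t q s" using Q by (intro mult_left_mono) (auto simp: Q_def)
    also have "\<dots> \<le> B r t" using Q that by (intro B_ge) auto
    finally show "y * w r t' q s \<le> B r t" .
  qed (use B_nonneg that in auto)
  \<comment> \<open>Moving from \<open>t\<close> to \<open>t'\<close> shrinks a weight by at most
    the factor \<open>exp (t - t')\<close>. Together with \<open>B_antimono\<close> and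
    \<open>B_M\<close> this controls the variation in \<open>t\<close>.\<close>
  have B_exp: "B r t \<le> exp (t' - t) * B r t'" if "0 \<le> r" "t \<le> t'" for r t t'
  proof (rule B_le)
    fix q s y assume Q: "Q r q s y"
    then have "q / r \<le> 2" using that by (cases "r = 0") (auto simp: field_simps Q_def)
    moreover have "exp (- max 0 (t - s)) \<le> exp (t' - t) * exp (- max 0 (t' - s))"
      using that by (simp flip: exp_add)
    ultimately have "w r t q s \<le> exp (t' - t) * w r t' q s" unfolding w_def
      by (simp add: mult_right_mono flip: mult.assoc)
    then have "y * w r t q s \<le> y * (exp (t' - t) * w r t' q s)"
      using Q by (intro mult_left_mono) (auto simp: Q_def)
    also have "\<dots> = exp (t' - t) * (y * w r t' q s)" by simp
    also have "\<dots> \<le> exp (t' - t) * B r t'" using Q that by (intro mult_left_mono B_ge) auto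
    finally show "y * w r t q s \<le> exp (t' - t) * B r t'" .
  qed (use B_nonneg that in auto)
  have B_cont_t: "continuous_on {0..} (B r)" if "0 \<le> r" for r
    unfolding continuous_on_eq_continuous_within continuous_within
  proof
    fix t :: real
    have lip: "\<bar>B r t - B r t'\<bar> \<le> M (2 * r) * (exp (t' - t) - 1)" if "t \<le> t'" for t t'
    proof -
      have "B r t - B r t' \<le> B r t' * (exp (t' - t) - 1)"
        using B_exp[OF \<open>0 \<le> r\<close> that] by (simp add: algebra_simps)
      also have "\<dots> \<le> M (2 * r) * (exp (t' - t) - 1)"
        using B_M[OF \<open>0 \<le> r\<close>] that by (intro mult_right_mono) auto
      finally show ?thesis using B_antimono[OF \<open>0 \<le> r\<close> that] by simp
    qed
    have "\<bar>B r t' - B r t\<bar> \<le> M (2 * r) * (exp \<bar>t' - t\<bar> - 1)" for t'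
      using lip[of t t'] lip[of t' t] by (cases "t \<le> t'") (auto simp: abs_minus_commute)
    then have "eventually (\<lambda>t'. norm (B r t' - B r t) \<le> M (2 * r) * (exp \<bar>t' - t\<bar> - 1)) (at t within {0..})"
      by simp
    moreover have "((\<lambda>t'. M (2 * r) * (exp \<bar>t' - t\<bar> - 1)) \<longlongrightarrow> 0) (at t within {0..})"
      by (auto intro!: tendsto_eq_intros)
    ultimately have "((\<lambda>t'. B r t' - B r t) \<longlongrightarrow> 0) (at t within {0..})"
      by (rule Lim_null_comparison)
    then show "(B r \<longlongrightarrow> B r t) (at t within {0..})" by (rule LIM_zero_cancel)
  qed
  have exp_lim: "((\<lambda>t. K * exp (- t)) \<longlongrightarrow> 0) at_top" for K :: real
    by (intro tendsto_mult_right_zero filterlim_compose[OF exp_at_bot filterlim_uminus_at_bot_at_top])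
  have B_lim: "(B r \<longlongrightarrow> 0) at_top" if "0 \<le> r" for r
    unfolding tendsto_iff
  proof (intro allI impI)
    fix e :: real assume "0 < e"
    then obtain T where T: "T \<ge> 0" "\<forall>q s y. P q s y \<longrightarrow> 0 \<le> q \<longrightarrow> q \<le> 2 * r \<longrightarrow> T \<le> s \<longrightarrow> y \<le> e / 2"
      using decay[of "e / 2" "2 * r"] by auto
    \<comment> \<open>Points given at times \<open>s \<ge> T\<close> lie below \<open>e / 2\<close>
      by \<open>decay\<close>; those with \<open>s < T\<close> have weight at most
      \<open>exp (T - t)\<close>.\<close>
    have bound: "B r t \<le> e / 2 + M (2 * r) * exp (T - t)" for t
    proof (rule B_le)
      fix q s y assume Q: "Q r q s y"
      show "y * w r t q s \<le> e / 2 + M (2 * r) * exp (T - t)"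
      proof (cases "T \<le> s")
        case True
        then have "y \<le> e / 2" using T Q by (auto simp: Q_def)
        then show ?thesis using term_le[OF Q that, of t] M_nonneg[of "2 * r"]
          by (simp add: add_increasing2)
      next
        case False
        have "y * w r t q s \<le> M (2 * r) * exp (T - t)"
        proof (rule mult_mono)
          show "y \<le> M (2 * r)" using Q by (auto simp: Q_def intro: M)
          have "w r t q s \<le> exp (- max 0 (t - s)) * 1"
            unfolding w_def by (intro mult_left_mono) auto
          also have "\<dots> \<le> exp (T - t)" using False by simp
          finally show "w r t q s \<le> exp (T - t)" .
        qed (use w[of r q] Q M_nonneg that in \<open>auto simp: Q_def\<close>)
        then show ?thesis using \<open>0 < e\<close> by simp
      qed
    qed (use M_nonneg \<open>0 < e\<close> in \<open>auto intro!: add_nonneg_nonneg\<close>)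
    have "((\<lambda>t. M (2 * r) * exp (T - t)) \<longlongrightarrow> 0) at_top"
      using exp_lim[of "M (2 * r) * exp T"] by (simp add: exp_diff exp_minus field_simps)
    then have "eventually (\<lambda>t. M (2 * r) * exp (T - t) < e / 2) at_top"
      using \<open>0 < e\<close> by (intro order_tendstoD) auto
    then show "eventually (\<lambda>t. dist (B r t) 0 < e) at_top"
    proof eventually_elim
      case (elim t)
      then show ?case using bound[of t] B_nonneg[OF that, of t] by simp
    qed
  qed
  \<comment> \<open>The supremum is only weakly monotone in each argument; the summand
    \<open>r * exp (- t)\<close> makes the monotonicity strict.\<close>
  define \<beta> where "\<beta> r t = B r t + r * exp (- t)" for r t
  have "class_KL \<beta>"
    unfolding class_KL_def class_K_def
  proof (intro conjI allI impI)
    fix t :: real assume "0 \<le> t"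
    show "continuous_on {0..} (\<lambda>r. \<beta> r t)"
      unfolding \<beta>_def by (intro continuous_intros B_cont_r)
    show "\<beta> 0 t = 0" by (simp add: \<beta>_def B_0)
    fix r s :: real assume "0 \<le> r" "r < s"
    then have "B r t \<le> B s t"
      using B_mono[of r s t] B_0[of t] B_nonneg[of s t] by (cases "r = 0") auto
    then show "\<beta> r t < \<beta> s t" using \<open>r < s\<close> by (simp add: \<beta>_def add_le_less_mono)
  next
    fix r :: real assume "0 < r"
    show "continuous_on {0..} (\<beta> r)"
      unfolding \<beta>_def using \<open>0 < r\<close> by (intro continuous_intros B_cont_t[of r]) auto
    show "\<beta> r t < \<beta> r s" if "s < t" for s t
      using B_antimono[of r s t] \<open>0 < r\<close> that by (simp add: \<beta>_def add_le_less_mono)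
    show "(\<beta> r \<longlongrightarrow> 0) at_top"
      unfolding \<beta>_def using tendsto_add[OF B_lim exp_lim, of r r] \<open>0 < r\<close> by simp
  qed
  moreover have "y \<le> \<beta> r t" if "P r t y" "0 \<le> r" "0 \<le> t" for r t y
  \<comment> \<open>For \<open>r \<noteq> 0\<close> the point \<open>(r, t, y)\<close> has weight 1
    at its own position. In the remaining cases \<open>y \<le> 0\<close>, which for
    \<open>r = 0\<close> follows from \<open>small\<close>.\<close>
  proof (cases "0 \<le> y \<and> r \<noteq> 0")
    case True
    then have "Q r r t y" "w r t r t = 1" using that by (auto simp: Q_def w_def)
    then have "y \<le> B r t" using B_ge[of r r t y t] that by simp
    then show ?thesis using that by (simp add: \<beta>_def add_increasing2)
  next
    case False
    have "y \<le> 0"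
    proof (cases "0 \<le> y")
      case True
      then have "r = 0" using False by simp
      show ?thesis
      proof (rule field_le_epsilon)
        fix e :: real assume "0 < e"
        then show "y \<le> 0 + e" using small \<open>r = 0\<close> that by (metis add_0 less_imp_le order_refl)
      qed
    qed simp
    then show ?thesis using B_nonneg[OF that(2), of t] that(2) by (simp add: \<beta>_def add_nonneg_nonneg order_trans)
  qed
  ultimately show ?thesis by blast
qed

text \<open>All points are placed at time 0, so the decay condition is vacuous from time 1 on, and
  \<open>\<kappa>\<close> is the section at time 0 of the resulting class KL function.\<close>

lemma K_majorant:
  fixes P :: "real \<Rightarrow> real \<Rightarrow> bool"
  assumes bounded: "\<And>R. \<exists>M. \<forall>r y. P r y \<longrightarrow> 0 \<le> r \<longrightarrow> r \<le> R \<longrightarrow> y \<le> M"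
    and small: "\<And>e. 0 < e \<Longrightarrow> \<exists>d>0. \<forall>r y. P r y \<longrightarrow> 0 \<le> r \<longrightarrow> r \<le> d \<longrightarrow> y \<le> e"
  shows "\<exists>\<kappa>. class_K \<kappa> \<and> (\<forall>r y. P r y \<longrightarrow> 0 \<le> r \<longrightarrow> y \<le> \<kappa> r)"
proof -
  have "\<exists>\<beta>. class_KL \<beta> \<and> (\<forall>r t y. (t = 0 \<and> P r y) \<longrightarrow> 0 \<le> r \<longrightarrow> 0 \<le> t \<longrightarrow> y \<le> \<beta> r t)"
  proof (rule KL_majorant)
    show "\<exists>T\<ge>0. \<forall>r (t::real) y. t = 0 \<and> P r y \<longrightarrow> 0 \<le> r \<longrightarrow> r \<le> R \<longrightarrow> T \<le> t \<longrightarrow> y \<le> e" for R e :: real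
      by (intro exI[of _ 1]) auto
  qed (use bounded small in \<open>meson+\<close>)
  then obtain \<beta> where "class_KL \<beta>" "\<forall>r t y. (t = 0 \<and> P r y) \<longrightarrow> 0 \<le> r \<longrightarrow> 0 \<le> t \<longrightarrow> y \<le> \<beta> r t"
    by blast
  then show ?thesis
    by (intro exI[of _ "\<lambda>r. \<beta> r 0"]) (auto simp: class_KL_def)
qed

subsection \<open>Shifted inputs\<close>

lemma AE_lebesgue_shift:
  fixes t :: real
  assumes "AE s in lebesgue. P s"
  shows "AE s in lebesgue. P (t + s)"
proof -
  obtain N where N: "{s. \<not> P s} \<subseteq> N" "N \<in> null_sets lebesgue"
    using assms by (auto simp: eventually_ae_filter)
  have "negligible ((+) (- t) ` N)"
    using N(2) by (intro negligible_translation) (simp add: negligible_iff_null_sets)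
  moreover have "{s. \<not> P (t + s)} \<subseteq> (+) (- t) ` N"
  proof
    fix s assume "s \<in> {s. \<not> P (t + s)}"
    then have "t + s \<in> N" using N(1) by auto
    then show "s \<in> (+) (- t) ` N" by (intro image_eqI[of _ _ "t + s"]) auto
  qed
  ultimately show ?thesis
    by (auto simp: eventually_ae_filter negligible_iff_null_sets)
qed

lemma AE_shifted_bound:
  assumes "AE s in lebesgue. 0 \<le> s \<longrightarrow> norm (u s) \<le> C" "0 \<le> (t::real)"
  shows "AE s in lebesgue. 0 \<le> s \<longrightarrow> norm (u (t + s)) \<le> C"
  using AE_lebesgue_shift[OF assms(1), of t] by (rule AE_mp) (use assms(2) in auto)

lemma Linf_inputs_shift:
  assumes "u \<in> Linf_inputs" "0 \<le> t"
  shows "(\<lambda>s. u (t + s)) \<in> Linf_inputs"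
proof -
  \<comment> \<open>Continuity gives Borel measurability only; for the completed
    \<open>lebesgue\<close> the translation is treated as an affine map with scaling 1.\<close>
  have "(\<lambda>s. t + s) \<in> lebesgue \<rightarrow>\<^sub>M lebesgue"
    using lebesgue_affine_measurable[of "\<lambda>_. 1" t] by simp
  then have "(\<lambda>s. t + s) \<in> restrict_space lebesgue {0..} \<rightarrow>\<^sub>M restrict_space lebesgue {0..}"
    using \<open>0 \<le> t\<close> by (intro measurable_restrict_space2 measurable_restrict_space1) (auto simp: space_restrict_space)
  then have "(\<lambda>s. u (t + s)) \<in> borel_measurable (restrict_space lebesgue {0..})"
    using assms(1) by (auto simp: Linf_inputs_def intro: measurable_compose)
  then show ?thesis
    using assms AE_shifted_bound[of u _ t] unfolding Linf_inputs_def by blast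
qed

text \<open>Every essential bound of \<open>u\<close> also bounds the shifted input, so the second
  infimum runs over a larger set. Membership in \<open>Linf_inputs\<close> makes the smaller set
  nonempty, without which \<open>Inf\<close> would be unspecified.\<close>

lemma linf_norm_shift_le:
  assumes "u \<in> Linf_inputs" "0 \<le> t"
  shows "linf_norm (\<lambda>s. u (t + s)) \<le> linf_norm u"
  unfolding linf_norm_def
proof (rule cInf_superset_mono)
  obtain C where "AE s in lebesgue. 0 \<le> s \<longrightarrow> norm (u s) \<le> C"
    using assms by (auto simp: Linf_inputs_def)
  then have "AE s in lebesgue. 0 \<le> s \<longrightarrow> norm (u s) \<le> max 0 C"
    by (rule AE_mp) auto
  then show "{C. 0 \<le> C \<and> (AE s in lebesgue. 0 \<le> s \<longrightarrow> norm (u s) \<le> C)} \<noteq> {}"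
    by (auto intro!: exI[of _ "max 0 C"])
  show "bdd_below {C. 0 \<le> C \<and> (AE s in lebesgue. 0 \<le> s \<longrightarrow> norm (u (t + s)) \<le> C)}"
    by (auto intro: bdd_belowI)
qed (use AE_shifted_bound[OF _ assms(2)] in blast)

lemma linf_norm_nonneg:
  assumes "u \<in> Linf_inputs"
  shows "0 \<le> linf_norm u"
  unfolding linf_norm_def
proof (rule cInf_greatest)
  obtain C where "AE s in lebesgue. 0 \<le> s \<longrightarrow> norm (u s) \<le> C"
    using assms by (auto simp: Linf_inputs_def)
  then have "AE s in lebesgue. 0 \<le> s \<longrightarrow> norm (u s) \<le> max 0 C"
    by (rule AE_mp) auto
  then show "{C. 0 \<le> C \<and> (AE s in lebesgue. 0 \<le> s \<longrightarrow> norm (u s) \<le> C)} \<noteq> {}"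
    by (auto intro!: exI[of _ "max 0 C"])
qed auto

subsection \<open>Stability estimates from a Lyapunov function\<close>

text \<open>The comparison functions are fixed here, and \<open>V_le\<close> is demanded at 0 as
  well, where the definition of a Lyapunov function is silent; the main theorem recovers it by
  continuity.\<close>

locale lyapunov_control_system =
  fixes \<phi> :: "real \<Rightarrow> 'x::banach \<Rightarrow> (real \<Rightarrow> 'u::banach) \<Rightarrow> 'x"
    and V :: "'x \<Rightarrow> real" and \<psi> \<alpha> \<sigma> :: "real \<Rightarrow> real"
  assumes system: "forward_complete_control_system \<phi>"
    and CEP: "CEP \<phi>" and BRS: "BRS \<phi>"
    and V_cont: "continuous_on UNIV V" and V_nonneg: "0 \<le> V x"
    and V_le: "V x \<le> \<psi> (norm x)"
    and \<psi>: "class_K \<psi>" and \<alpha>: "class_Kinf \<alpha>" and \<sigma>: "class_K \<sigma>"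
    and dini: "u \<in> Linf_inputs \<Longrightarrow>
      dini_derivative V \<phi> x u \<le> ereal (- \<alpha> (norm x) + \<sigma> (linf_norm u))"
begin

section \<open>Decrease of \<open>V\<close> along trajectories\<close>

lemma \<alpha>_K: "class_K \<alpha>"
  using \<alpha> by (simp add: class_Kinf_def)

lemma flow_0: "u \<in> Linf_inputs \<Longrightarrow> \<phi> 0 x u = x"
  using system unfolding forward_complete_control_system_def by blast

lemma flow_cont:
  assumes "u \<in> Linf_inputs" "0 \<le> a"
  shows "continuous_on {a..b} (\<lambda>t. \<phi> t x u)"
proof -
  have "continuous_on {0..} (\<lambda>t. \<phi> t x u)"
    using system assms(1) unfolding forward_complete_control_system_def by blast
  then show ?thesis by (rule continuous_on_subset) (use assms(2) in auto)
qed

lemma cocycle: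
  assumes "u \<in> Linf_inputs" "0 \<le> s" "s \<le> t"
  shows "\<phi> t x u = \<phi> (t - s) (\<phi> s x u) (\<lambda>r. u (s + r))"
proof -
  have "\<phi> (t - s) (\<phi> s x u) (\<lambda>r. u (s + r)) = \<phi> (s + (t - s)) x u"
    using system assms unfolding forward_complete_control_system_def
    by (metis diff_ge_0_iff_ge)
  then show ?thesis by simp
qed

text \<open>By the cocycle property, the difference quotient along the trajectory at time
  \<open>s\<close> is the one defining the Dini derivative at \<open>\<phi> s x u\<close> for the
  shifted input. The norm of that input is no larger, so the Lyapunov inequality holds with
  \<open>\<sigma> (linf_norm u)\<close> at every time.\<close>

lemma V_decrease:
  assumes u: "u \<in> Linf_inputs" and ab: "0 \<le> a" "a \<le> b"
    and rate: "\<And>s. s \<in> {a..b} \<Longrightarrow> c \<le> \<alpha> (norm (\<phi> s x u)) - \<sigma> (linf_norm u)"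
  shows "V (\<phi> b x u) \<le> V (\<phi> a x u) - c * (b - a)"
proof (rule decrease_if_Dini_derivative_le[OF _ ab(2)])
  show "continuous_on {a..b} (\<lambda>s. V (\<phi> s x u))"
    by (rule continuous_on_compose2[OF V_cont flow_cont[OF u ab(1)]]) auto
  fix s assume s: "a \<le> s" "s < b"
  let ?v = "\<lambda>r. u (s + r)"
  have v: "?v \<in> Linf_inputs" using Linf_inputs_shift[OF u] s ab by simp
  have "\<sigma> (linf_norm ?v) \<le> \<sigma> (linf_norm u)"
    using linf_norm_shift_le[OF u, of s] linf_norm_nonneg[OF v] s ab
    by (intro class_K_mono[OF \<sigma>]) auto
  then have "- \<alpha> (norm (\<phi> s x u)) + \<sigma> (linf_norm ?v) \<le> - c" using rate[of s] s by simp
  then have "dini_derivative V \<phi> (\<phi> s x u) ?v \<le> ereal (- c)"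
    using dini[OF v, of "\<phi> s x u"] by (meson ereal_less_eq(3) order_trans)
  moreover have "Limsup (at_right 0) (\<lambda>h. ereal ((V (\<phi> (s + h) x u) - V (\<phi> s x u)) / h))
      = dini_derivative V \<phi> (\<phi> s x u) ?v"
    unfolding dini_derivative_def
  proof (rule Limsup_eq)
    show "eventually (\<lambda>h. ereal ((V (\<phi> (s + h) x u) - V (\<phi> s x u)) / h) =
        ereal ((V (\<phi> h (\<phi> s x u) ?v) - V (\<phi> s x u)) / h)) (at_right 0)"
      using eventually_at_right_less[of "0::real"]
    proof eventually_elim
      case (elim h)
      then show ?case using cocycle[OF u, of s "s + h" x] s ab by simp
    qed
  qed
  ultimately show "Limsup (at_right 0) (\<lambda>h. ereal ((V (\<phi> (s + h) x u) - V (\<phi> s x u)) / h)) \<le> ereal (- c)"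
    by simp
qed

lemma exit_time_bound:
  assumes "u \<in> Linf_inputs" "0 \<le> a" "a \<le> b" "0 < c"
    and "\<And>s. s \<in> {a..b} \<Longrightarrow> c \<le> \<alpha> (norm (\<phi> s x u)) - \<sigma> (linf_norm u)"
  shows "b - a \<le> V (\<phi> a x u) / c"
  using V_decrease[OF assms(1-3,5)] V_nonneg[of "\<phi> b x u"] \<open>0 < c\<close> by (simp add: field_simps)

lemma last_time_norm_at_level:
  assumes "u \<in> Linf_inputs" "0 \<le> a" "a \<le> b" "C \<le> norm (\<phi> b x u)"
  obtains s where "a \<le> s" "s \<le> b" "norm (\<phi> s x u) \<le> max C (norm (\<phi> a x u))"
    "\<And>r. r \<in> {s..b} \<Longrightarrow> C \<le> norm (\<phi> r x u)"
proof -
  have "continuous_on {a..b} (\<lambda>s. norm (\<phi> s x u))"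
    by (intro continuous_on_norm flow_cont assms)
  from last_time_at_level[OF this assms(3,4)] show thesis by (auto intro: that)
qed

text \<open>A substitute for the gain \<open>\<alpha>\<^sup>-\<^sup>1 \<circ> 2\<sigma>\<close>.\<close>

lemma gain_exists:
  "\<exists>\<gamma>. class_K \<gamma> \<and> (\<forall>s y. 0 \<le> s \<longrightarrow> 0 \<le> y \<longrightarrow> \<gamma> s < y \<longrightarrow> 2 * \<sigma> s \<le> \<alpha> y)"
proof -
  \<comment> \<open>This is the contrapositive: \<open>\<gamma>\<close> majorises the levels
    \<open>y\<close> at which \<open>\<alpha> y\<close> is still at most
    \<open>2 * \<sigma> s\<close>. Unboundedness of \<open>\<alpha>\<close> bounds these levels for
    bounded \<open>s\<close>.\<close>
  have "\<exists>\<gamma>. class_K \<gamma> \<and> (\<forall>s y. (0 \<le> y \<and> \<alpha> y \<le> 2 * \<sigma> s) \<longrightarrow> 0 \<le> s \<longrightarrow> y \<le> \<gamma> s)"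
  proof (rule K_majorant)
    fix R :: real
    obtain M where M: "M \<ge> 0" "2 * \<sigma> R < \<alpha> M" using \<alpha> by (auto simp: class_Kinf_def)
    show "\<exists>M. \<forall>s y. 0 \<le> y \<and> \<alpha> y \<le> 2 * \<sigma> s \<longrightarrow> 0 \<le> s \<longrightarrow> s \<le> R \<longrightarrow> y \<le> M"
    proof (intro exI[of _ M] allI impI)
      fix s y assume *: "0 \<le> y \<and> \<alpha> y \<le> 2 * \<sigma> s" "0 \<le> s" "s \<le> R"
      then have "\<alpha> y < \<alpha> M" using class_K_mono[OF \<sigma>, of s R] M by simp
      then show "y \<le> M" using class_K_mono[OF \<alpha>_K M(1), of y] by (cases "y \<le> M") auto
    qed
  next
    fix e :: real assume "0 < e"
    \<comment> \<open>Dividing by 3 leaves \<open>2 * \<sigma> d\<close> strictly below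
      \<open>\<alpha> e\<close>.\<close>
    then obtain d where d: "d > 0" "\<sigma> d \<le> \<alpha> e / 3"
      using class_K_small[OF \<sigma>, of "\<alpha> e / 3"] class_K_pos[OF \<alpha>_K] by auto
    show "\<exists>d>0. \<forall>s y. 0 \<le> y \<and> \<alpha> y \<le> 2 * \<sigma> s \<longrightarrow> 0 \<le> s \<longrightarrow> s \<le> d \<longrightarrow> y \<le> e"
    proof (intro exI[of _ d] conjI allI impI)
      fix s y assume *: "0 \<le> y \<and> \<alpha> y \<le> 2 * \<sigma> s" "0 \<le> s" "s \<le> d"
      then have "\<alpha> y < \<alpha> e" using class_K_mono[OF \<sigma>, of s d] d class_K_pos[OF \<alpha>_K \<open>0 < e\<close>] by simp
      then show "y \<le> e" using class_K_mono[OF \<alpha>_K, of e y] \<open>0 < e\<close> by (cases "y \<le> e") auto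
    qed (rule d)
  qed
  then show ?thesis by (meson less_imp_le linorder_not_less not_le_imp_less)
qed

definition "\<gamma> = (SOME \<gamma>. class_K \<gamma> \<and> (\<forall>s y. 0 \<le> s \<longrightarrow> 0 \<le> y \<longrightarrow> \<gamma> s < y \<longrightarrow> 2 * \<sigma> s \<le> \<alpha> y))"

lemma \<gamma>_K: "class_K \<gamma>"
  and \<gamma>_gain: "0 \<le> s \<Longrightarrow> \<gamma> s < y \<Longrightarrow> 2 * \<sigma> s \<le> \<alpha> y"
proof -
  have *: "class_K \<gamma> \<and> (\<forall>s y. 0 \<le> s \<longrightarrow> 0 \<le> y \<longrightarrow> \<gamma> s < y \<longrightarrow> 2 * \<sigma> s \<le> \<alpha> y)"
    unfolding \<gamma>_def by (rule someI_ex[OF gain_exists])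
  then show "class_K \<gamma>" by simp
  show "2 * \<sigma> s \<le> \<alpha> y" if "0 \<le> s" "\<gamma> s < y"
    using * that class_K_nonneg[of \<gamma> s] by simp
qed

text \<open>The factor 2 in the gain lets half of \<open>\<alpha> (norm z)\<close> pay for the
  input; the other half is at least \<open>\<alpha> e / 2\<close>, a rate independent of
  \<open>z\<close> and \<open>u\<close>.\<close>

lemma rate_above_gain:
  assumes "u \<in> Linf_inputs" "0 < e" "e + \<gamma> (linf_norm u) \<le> norm z"
  shows "\<alpha> e / 2 \<le> \<alpha> (norm z) - \<sigma> (linf_norm u)"
proof -
  have n: "0 \<le> linf_norm u" by (rule linf_norm_nonneg[OF assms(1)])
  then have "2 * \<sigma> (linf_norm u) \<le> \<alpha> (norm z)"
    using assms by (intro \<gamma>_gain) auto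
  moreover have "\<alpha> e \<le> \<alpha> (norm z)"
    using assms class_K_nonneg[OF \<gamma>_K n] by (intro class_K_mono[OF \<alpha>_K]) auto
  ultimately show ?thesis by simp
qed

section \<open>Uniform boundedness and uniform stability\<close>

lemma uniformly_bounded:
  assumes "0 < R"
  shows "\<exists>M. \<forall>x. \<forall>u\<in>Linf_inputs. \<forall>t\<ge>0. norm x \<le> R \<longrightarrow> linf_norm u \<le> R \<longrightarrow> norm (\<phi> t x u) \<le> M"
proof -
  \<comment> \<open>Trajectories start below this level since \<open>R \<le> C\<close>, and above it
    \<open>rate_above_gain\<close> applies with \<open>e = 1\<close>.\<close>
  define C where "C = max R (1 + \<gamma> R)"
  have C: "0 < C" "R \<le> C" using assms by (auto simp: C_def)
  have a1: "0 < \<alpha> 1" by (rule class_K_pos[OF \<alpha>_K]) simp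
  \<comment> \<open>From a state of norm at most \<open>C\<close>, where \<open>V\<close> is at most
    \<open>\<psi> C\<close>, a decrease at rate \<open>\<alpha> 1 / 2\<close> cannot last longer
    than this, so BRS on this horizon covers the last excursion.\<close>
  define \<tau> where "\<tau> = \<psi> C / (\<alpha> 1 / 2) + 1"
  have "0 < \<tau>" unfolding \<tau>_def using a1 class_K_pos[OF \<psi> C(1)] by (intro add_pos_pos divide_pos_pos) auto
  then obtain M where M: "\<And>t x u. u \<in> Linf_inputs \<Longrightarrow> norm x \<le> C \<Longrightarrow> linf_norm u \<le> C \<Longrightarrow>
      t \<in> {0..\<tau>} \<Longrightarrow> norm (\<phi> t x u) \<le> M"
    using BRS C(1) unfolding BRS_def bdd_above_def by blast
  have "norm (\<phi> t x u) \<le> max C M"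
    if u: "u \<in> Linf_inputs" and t: "0 \<le> t" and x: "norm x \<le> R" and n: "linf_norm u \<le> R" for t x u
  proof (cases "C \<le> norm (\<phi> t x u)")
    case True
    obtain s where s: "0 \<le> s" "s \<le> t" "norm (\<phi> s x u) \<le> max C (norm (\<phi> 0 x u))"
      "\<And>r. r \<in> {s..t} \<Longrightarrow> C \<le> norm (\<phi> r x u)"
      using last_time_norm_at_level[OF u _ t True] by auto
    have sC: "norm (\<phi> s x u) \<le> C" using s(3) x C by (simp add: flow_0[OF u])
    have "\<gamma> (linf_norm u) \<le> \<gamma> R" using n linf_norm_nonneg[OF u] by (intro class_K_mono[OF \<gamma>_K])
    then have "t - s \<le> V (\<phi> s x u) / (\<alpha> 1 / 2)"
      using s a1 by (intro exit_time_bound[OF u] rate_above_gain[OF u]) (force simp: C_def)+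
    also have "\<dots> \<le> \<psi> C / (\<alpha> 1 / 2)"
      using V_le[of "\<phi> s x u"] class_K_mono[OF \<psi> _ sC] a1 by (intro divide_right_mono) force+
    finally have "t - s \<in> {0..\<tau>}" using s by (simp add: \<tau>_def)
    then have "norm (\<phi> (t - s) (\<phi> s x u) (\<lambda>r. u (s + r))) \<le> M"
      using linf_norm_shift_le[OF u s(1)] n C sC by (intro M Linf_inputs_shift[OF u s(1)]) auto
    then show ?thesis using cocycle[OF u s(1,2), of x] by simp
  qed simp
  then show ?thesis by blast
qed

text \<open>Smallness of the state does not bound the time spent above a level, but smallness of \<open>V\<close> does: between
  the last visits to the levels \<open>\<eta>\<close> and \<open>\<delta>\<close> the function \<open>V\<close> does not increase, so it is at most
  \<open>\<psi> \<eta>\<close> at the latter, and with \<open>\<eta>\<close> small against \<open>\<delta>\<close> the remaining time is at most 1.\<close>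

lemma uniformly_stable:
  assumes "0 < e"
  shows "\<exists>d>0. \<forall>x. \<forall>u\<in>Linf_inputs. \<forall>t\<ge>0. norm x \<le> d \<longrightarrow> linf_norm u \<le> d \<longrightarrow> norm (\<phi> t x u) \<le> e"
proof -
  obtain \<delta>0 where \<delta>0: "\<delta>0 > 0" "\<forall>t x. \<forall>u\<in>Linf_inputs. t \<in> {0..1} \<longrightarrow> norm x \<le> \<delta>0 \<longrightarrow>
      linf_norm u \<le> \<delta>0 \<longrightarrow> norm (\<phi> t x u) \<le> e"
    using CEP assms unfolding CEP_def by (metis zero_less_one)
  \<comment> \<open>CEP covers excursions of length 1 from the ball of radius
    \<open>\<delta>\<close>; the cap by \<open>e\<close> settles states that are below
    \<open>\<delta>\<close> at time \<open>t\<close>.\<close>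
  define \<delta> where "\<delta> = min \<delta>0 e"
  have \<delta>: "0 < \<delta>" "\<delta> \<le> \<delta>0" "\<delta> \<le> e" using \<delta>0 assms by (auto simp: \<delta>_def)
  have \<alpha>\<delta>: "0 < \<alpha> \<delta>" using class_K_pos[OF \<alpha>_K \<delta>(1)] .
  obtain \<eta>0 where \<eta>0: "\<eta>0 > 0" "\<psi> \<eta>0 \<le> \<alpha> \<delta> / 2"
    using class_K_small[OF \<psi>, of "\<alpha> \<delta> / 2"] \<alpha>\<delta> by auto
  define \<eta> where "\<eta> = min \<eta>0 \<delta>"
  have \<eta>: "0 < \<eta>" "\<eta> \<le> \<eta>0" "\<eta> \<le> \<delta>" using \<eta>0 \<delta> by (auto simp: \<eta>_def)
  have \<alpha>\<eta>: "0 < \<alpha> \<eta>" "\<alpha> \<eta> \<le> \<alpha> \<delta>"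
    using class_K_pos[OF \<alpha>_K] class_K_mono[OF \<alpha>_K] \<eta> by auto
  \<comment> \<open>Such inputs cost at most \<open>\<alpha> \<eta> / 2\<close>: \<open>V\<close>
    does not increase above level \<open>\<eta>\<close>, and it decreases at rate
    \<open>\<alpha> \<delta> / 2\<close> above level \<open>\<delta>\<close>.\<close>
  obtain \<zeta> where \<zeta>: "\<zeta> > 0" "\<sigma> \<zeta> \<le> \<alpha> \<eta> / 2"
    using class_K_small[OF \<sigma>, of "\<alpha> \<eta> / 2"] \<alpha>\<eta> by auto
  have "norm (\<phi> t x u) \<le> e"
    if u: "u \<in> Linf_inputs" and t: "0 \<le> t" and x: "norm x \<le> min \<zeta> \<eta>" and n: "linf_norm u \<le> min \<zeta> \<eta>" for t x u
  proof (cases "\<delta> \<le> norm (\<phi> t x u)")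
    case True
    have \<sigma>u: "\<sigma> (linf_norm u) \<le> \<alpha> \<eta> / 2"
      using class_K_mono[OF \<sigma> linf_norm_nonneg[OF u], of \<zeta>] n \<zeta> by simp
    obtain s where s: "0 \<le> s" "s \<le> t" "norm (\<phi> s x u) \<le> max \<eta> (norm (\<phi> 0 x u))"
      "\<And>r. r \<in> {s..t} \<Longrightarrow> \<eta> \<le> norm (\<phi> r x u)"
      using last_time_norm_at_level[OF u order_refl t, of \<eta> x] True \<eta> by auto
    have s\<eta>: "norm (\<phi> s x u) \<le> \<eta>" using s(3) x by (simp add: flow_0[OF u])
    obtain s' where s': "s \<le> s'" "s' \<le> t" "norm (\<phi> s' x u) \<le> max \<delta> (norm (\<phi> s x u))"
      "\<And>r. r \<in> {s'..t} \<Longrightarrow> \<delta> \<le> norm (\<phi> r x u)"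
      using last_time_norm_at_level[OF u s(1,2) True] by auto
    have s'\<delta>: "norm (\<phi> s' x u) \<le> \<delta>" using s'(3) s\<eta> \<eta> by simp
    have "V (\<phi> s' x u) \<le> V (\<phi> s x u) - 0 * (s' - s)"
    proof (rule V_decrease[OF u s(1) s'(1)])
      fix r assume "r \<in> {s..s'}"
      then have "\<alpha> \<eta> \<le> \<alpha> (norm (\<phi> r x u))"
        using s(4)[of r] s' \<eta> by (intro class_K_mono[OF \<alpha>_K]) auto
      then show "0 \<le> \<alpha> (norm (\<phi> r x u)) - \<sigma> (linf_norm u)" using \<sigma>u \<alpha>\<eta> by simp
    qed
    also have "\<dots> \<le> \<psi> \<eta>"
      using V_le[of "\<phi> s x u"] class_K_mono[OF \<psi> _ s\<eta>] by force
    also have "\<dots> \<le> \<alpha> \<delta> / 2"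
      using class_K_mono[OF \<psi> _ \<eta>(2)] \<eta> \<eta>0 by simp
    finally have Vs': "V (\<phi> s' x u) \<le> \<alpha> \<delta> / 2" .
    have "t - s' \<le> V (\<phi> s' x u) / (\<alpha> \<delta> / 2)"
    proof (rule exit_time_bound[OF u _ s'(2)])
      fix r assume "r \<in> {s'..t}"
      then have "\<alpha> \<delta> \<le> \<alpha> (norm (\<phi> r x u))"
        using s'(4)[of r] \<delta> by (intro class_K_mono[OF \<alpha>_K]) auto
      then show "\<alpha> \<delta> / 2 \<le> \<alpha> (norm (\<phi> r x u)) - \<sigma> (linf_norm u)" using \<sigma>u \<alpha>\<eta> by simp
    qed (use s s' \<alpha>\<delta> in auto)
    also have "\<dots> \<le> 1" using Vs' \<alpha>\<delta> by (simp add: field_simps)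
    finally have "t - s' \<in> {0..1}" using s' by simp
    moreover have "0 \<le> s'" using s s' by simp
    ultimately have "norm (\<phi> (t - s') (\<phi> s' x u) (\<lambda>r. u (s' + r))) \<le> e"
      using \<delta>0(2) Linf_inputs_shift[OF u, of s'] linf_norm_shift_le[OF u, of s'] n s'\<delta> \<delta> \<eta> by auto
    then show ?thesis using cocycle[OF u \<open>0 \<le> s'\<close> s'(2), of x] by simp
  qed (use \<delta> in simp)
  then show ?thesis using \<zeta> \<eta> by (intro exI[of _ "min \<zeta> \<eta>"]) auto
qed

text \<open>With one radius \<open>r\<close> bounding both state and input,
  \<open>uniformly_bounded\<close> and \<open>uniformly_stable\<close> are the two hypotheses of
  \<open>K_majorant\<close>.\<close>

lemma uniform_bound_K:
  "\<exists>\<kappa>. class_K \<kappa> \<and> (\<forall>x. \<forall>u\<in>Linf_inputs. \<forall>t\<ge>0. norm (\<phi> t x u) \<le> \<kappa> (max (norm x) (linf_norm u)))"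
proof -
  let ?P = "\<lambda>r y. \<exists>x. \<exists>u\<in>Linf_inputs. \<exists>t\<ge>0. norm x \<le> r \<and> linf_norm u \<le> r \<and> y = norm (\<phi> t x u)"
  have "\<exists>\<kappa>. class_K \<kappa> \<and> (\<forall>r y. ?P r y \<longrightarrow> 0 \<le> r \<longrightarrow> y \<le> \<kappa> r)"
  proof (rule K_majorant)
    fix R :: real
    obtain M where M: "\<forall>x. \<forall>u\<in>Linf_inputs. \<forall>t\<ge>0. norm x \<le> max R 1 \<longrightarrow> linf_norm u \<le> max R 1 \<longrightarrow> norm (\<phi> t x u) \<le> M"
      using uniformly_bounded[of "max R 1"] less_max_iff_disj zero_less_one by blast
    show "\<exists>M. \<forall>r y. ?P r y \<longrightarrow> 0 \<le> r \<longrightarrow> r \<le> R \<longrightarrow> y \<le> M"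
      by (intro exI[of _ M]) (use M in fastforce)
  next
    fix e :: real assume "0 < e"
    then obtain d where d: "d > 0" "\<forall>x. \<forall>u\<in>Linf_inputs. \<forall>t\<ge>0. norm x \<le> d \<longrightarrow> linf_norm u \<le> d \<longrightarrow> norm (\<phi> t x u) \<le> e"
      using uniformly_stable by blast
    show "\<exists>d>0. \<forall>r y. ?P r y \<longrightarrow> 0 \<le> r \<longrightarrow> r \<le> d \<longrightarrow> y \<le> e"
      by (intro exI[of _ d]) (use d in fastforce)
  qed
  then obtain \<kappa> where \<kappa>: "class_K \<kappa>" "\<And>r y. ?P r y \<Longrightarrow> 0 \<le> r \<Longrightarrow> y \<le> \<kappa> r" by blast
  have "norm (\<phi> t x u) \<le> \<kappa> (max (norm x) (linf_norm u))" if "u \<in> Linf_inputs" "t \<ge> 0" for t x u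
  proof (rule \<kappa>(2))
    show "?P (max (norm x) (linf_norm u)) (norm (\<phi> t x u))"
      using that by (intro exI[of _ x] bexI[of _ u] exI[of _ t]) auto
  qed (simp add: le_max_iff_disj)
  then show ?thesis using \<kappa>(1) by blast
qed

section \<open>Uniform attractivity and the ISS estimate\<close>

lemma uniform_limit:
  assumes "0 < e"
  shows "\<exists>T\<ge>0. \<forall>x. \<forall>u\<in>Linf_inputs. norm x \<le> R \<longrightarrow>
    (\<exists>s\<in>{0..T}. norm (\<phi> s x u) \<le> e + \<gamma> (linf_norm u))"
proof (cases "0 \<le> R")
  case True
  have ae: "0 < \<alpha> e" using class_K_pos[OF \<alpha>_K assms] .
  \<comment> \<open>The extra 1 exceeds the longest possible stay above the level and so yields the
    contradiction.\<close>
  define T where "T = \<psi> R / (\<alpha> e / 2) + 1"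
  have T: "0 \<le> T" unfolding T_def using class_K_nonneg[OF \<psi> True] ae by (intro add_nonneg_nonneg) auto
  have "\<exists>s\<in>{0..T}. norm (\<phi> s x u) \<le> e + \<gamma> (linf_norm u)" if u: "u \<in> Linf_inputs" and x: "norm x \<le> R" for x u
  proof (rule ccontr)
    assume "\<not> ?thesis"
    then have "T - 0 \<le> V (\<phi> 0 x u) / (\<alpha> e / 2)"
      using ae T by (intro exit_time_bound[OF u] rate_above_gain[OF u assms]) force+
    also have "\<dots> \<le> \<psi> R / (\<alpha> e / 2)"
      using V_le[of x] class_K_mono[OF \<psi> _ x] ae by (intro divide_right_mono) (force simp: flow_0[OF u])+
    finally show False by (simp add: T_def)
  qed
  then show ?thesis using T by blast
next
  case False
  then show ?thesis using order_trans[OF norm_ge_zero] by blast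
qed

lemma ISS: "ISS \<phi>"
proof -
  obtain \<kappa> where \<kappa>: "class_K \<kappa>"
    and bound: "\<And>x u t. u \<in> Linf_inputs \<Longrightarrow> 0 \<le> t \<Longrightarrow> norm (\<phi> t x u) \<le> \<kappa> (max (norm x) (linf_norm u))"
    using uniform_bound_K by blast
  \<comment> \<open>The first summand absorbs the input in the estimate valid at all times; the
    second absorbs the neighbourhood of radius \<open>\<gamma> r\<close> reached after time
    \<open>T\<close>, plus the input acting from then on.\<close>
  define \<Gamma> where "\<Gamma> r = \<kappa> r + \<kappa> (2 * (\<gamma> r + 1 * r))" for r
  have \<Gamma>: "class_K \<Gamma>" unfolding \<Gamma>_def
    by (intro class_K_add \<kappa> class_K_compose[OF \<kappa>] class_K_compose[OF class_K_scaled_ident] \<gamma>_K class_K_scaled_ident)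
      auto
  \<comment> \<open>This weak triangle inequality separates the small level \<open>d / 2\<close>
    from the input terms.\<close>
  have K_add_le: "\<kappa> (a + b) \<le> \<kappa> (2 * a) + \<kappa> (2 * b)" if "0 \<le> a" "0 \<le> b" for a b
    using class_K_mono[OF \<kappa>, of "a + b" "2 * max a b"] class_K_nonneg[OF \<kappa>, of "2 * a"]
      class_K_nonneg[OF \<kappa>, of "2 * b"] that by (cases "a \<le> b") auto
  let ?P = "\<lambda>r t y. \<exists>x. \<exists>u\<in>Linf_inputs. norm x = r \<and> y = norm (\<phi> t x u) - \<Gamma> (linf_norm u)"
  \<comment> \<open>One bound serves two hypotheses of \<open>KL_majorant\<close>: boundedness, and
    smallness through \<open>\<kappa>\<close> near 0.\<close>
  have le_\<kappa>: "y \<le> \<kappa> R" if P: "?P r t y" and "0 \<le> t" "r \<le> R" for r t y R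
  proof -
    obtain x u where u: "u \<in> Linf_inputs" and x: "norm x = r" "y = norm (\<phi> t x u) - \<Gamma> (linf_norm u)"
      using P by blast
    have n: "0 \<le> linf_norm u" by (rule linf_norm_nonneg[OF u])
    have "norm (\<phi> t x u) \<le> \<kappa> (max r (linf_norm u))" using bound[OF u \<open>0 \<le> t\<close>, of x] x by simp
    also have "\<dots> \<le> \<kappa> r + \<kappa> (linf_norm u)"
      using class_K_nonneg[OF \<kappa> n] class_K_nonneg[OF \<kappa>, of r] x by (auto simp: max_def)
    also have "\<dots> \<le> \<kappa> R + \<Gamma> (linf_norm u)"
      using class_K_mono[OF \<kappa> _ \<open>r \<le> R\<close>] x class_K_nonneg[OF \<kappa>, of "2 * (\<gamma> (linf_norm u) + 1 * linf_norm u)"]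
        class_K_nonneg[OF \<gamma>_K n] n by (auto simp: \<Gamma>_def)
    finally show ?thesis using x by simp
  qed
  have "\<exists>\<beta>. class_KL \<beta> \<and> (\<forall>r t y. ?P r t y \<longrightarrow> 0 \<le> r \<longrightarrow> 0 \<le> t \<longrightarrow> y \<le> \<beta> r t)"
  proof (rule KL_majorant)
    show "\<exists>M. \<forall>r t y. ?P r t y \<longrightarrow> 0 \<le> r \<longrightarrow> r \<le> R \<longrightarrow> 0 \<le> t \<longrightarrow> y \<le> M" for R
      using le_\<kappa> by (intro exI[of _ "\<kappa> R"]) blast
    show "\<exists>d>0. \<forall>r t y. ?P r t y \<longrightarrow> 0 \<le> r \<longrightarrow> r \<le> d \<longrightarrow> 0 \<le> t \<longrightarrow> y \<le> e" if "0 < e" for e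
      using class_K_small[OF \<kappa> that] le_\<kappa> by (meson order_trans)
    fix R e :: real assume "0 < e"
    then obtain d where d: "d > 0" "\<kappa> d \<le> e" using class_K_small[OF \<kappa>] by blast
    obtain T where T: "T \<ge> 0" "\<forall>x. \<forall>u\<in>Linf_inputs. norm x \<le> R \<longrightarrow>
        (\<exists>s\<in>{0..T}. norm (\<phi> s x u) \<le> d / 2 + \<gamma> (linf_norm u))"
      using uniform_limit[of "d / 2" R] d by auto
    have "norm (\<phi> t x u) - \<Gamma> (linf_norm u) \<le> e"
      if u: "u \<in> Linf_inputs" and x: "norm x \<le> R" and t: "T \<le> t" for t x u
    proof -
      have n: "0 \<le> linf_norm u" by (rule linf_norm_nonneg[OF u])
      obtain s where s: "s \<in> {0..T}" "norm (\<phi> s x u) \<le> d / 2 + \<gamma> (linf_norm u)" using T u x by blast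
      let ?v = "\<lambda>r. u (s + r)"
      have v: "?v \<in> Linf_inputs" "linf_norm ?v \<le> linf_norm u"
        using Linf_inputs_shift[OF u] linf_norm_shift_le[OF u] s by auto
      have "norm (\<phi> t x u) \<le> \<kappa> (max (norm (\<phi> s x u)) (linf_norm ?v))"
        using cocycle[OF u, of s t x] bound[OF v(1), of "t - s" "\<phi> s x u"] s t by simp
      also have "\<dots> \<le> \<kappa> (d / 2 + (\<gamma> (linf_norm u) + 1 * linf_norm u))"
        using s v n class_K_nonneg[OF \<gamma>_K n] d by (intro class_K_mono[OF \<kappa>]) (auto simp: le_max_iff_disj)
      also have "\<dots> \<le> \<kappa> (2 * (d / 2)) + \<kappa> (2 * (\<gamma> (linf_norm u) + 1 * linf_norm u))"
        using d n class_K_nonneg[OF \<gamma>_K n] by (intro K_add_le) auto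
      also have "\<dots> \<le> e + \<Gamma> (linf_norm u)"
        using d class_K_nonneg[OF \<kappa> n] by (simp add: \<Gamma>_def)
      finally show ?thesis by simp
    qed
    then show "\<exists>T\<ge>0. \<forall>r t y. ?P r t y \<longrightarrow> 0 \<le> r \<longrightarrow> r \<le> R \<longrightarrow> T \<le> t \<longrightarrow> y \<le> e"
      using T(1) by blast
  qed
  then obtain \<beta> where \<beta>: "class_KL \<beta>" "\<And>r t y. ?P r t y \<Longrightarrow> 0 \<le> r \<Longrightarrow> 0 \<le> t \<Longrightarrow> y \<le> \<beta> r t"
    by blast
  have "norm (\<phi> t x u) \<le> \<beta> (norm x) t + \<Gamma> (linf_norm u)" if "u \<in> Linf_inputs" "0 \<le> t" for t x u
  proof -
    have "norm (\<phi> t x u) - \<Gamma> (linf_norm u) \<le> \<beta> (norm x) t"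
      by (rule \<beta>(2)) (use that in auto)
    then show ?thesis by simp
  qed
  then show ?thesis unfolding ISS_def using \<beta>(1) \<Gamma> by blast
qed

end

section \<open>The zero state space and the conclusion\<close>

lemma ISS_of_trivial_state_space:
  assumes "\<And>x::'x::banach. x = 0"
  shows "ISS (\<phi> :: real \<Rightarrow> 'x \<Rightarrow> (real \<Rightarrow> 'u::banach) \<Rightarrow> 'x)"
proof -
  \<comment> \<open>With no points to majorise, \<open>KL_majorant\<close> merely supplies some
    class KL function.\<close>
  obtain \<beta> where \<beta>: "class_KL \<beta>"
    using KL_majorant[of "\<lambda>_ _ _. False"] by (auto intro: exI[of _ 1])
  have "norm (\<phi> t x u) \<le> \<beta> (norm x) t + 1 * linf_norm u" if "u \<in> Linf_inputs" "0 \<le> t" for t x u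
  proof -
    have "norm (\<phi> t x u) = 0" using assms by (metis norm_zero)
    moreover have "0 \<le> \<beta> (norm x) t"
      using \<beta> that class_K_nonneg[of "\<lambda>r. \<beta> r t"] by (simp add: class_KL_def)
    ultimately show ?thesis using linf_norm_nonneg[OF that(1)] by simp
  qed
  moreover have "class_K (\<lambda>r. 1 * r)" by (rule class_K_scaled_ident) simp
  ultimately show ?thesis unfolding ISS_def using \<beta> by blast
qed

theorem mainTheorem9:
  fixes \<phi> :: "real \<Rightarrow> 'x::banach \<Rightarrow> (real \<Rightarrow> 'u::banach) \<Rightarrow> 'x"
  assumes "forward_complete_control_system \<phi>"
    and "CEP \<phi>"
    and "BRS \<phi>"
    and "\<exists>V. noncoercive_ISS_Lyapunov V \<phi>"
  shows "ISS \<phi>"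
proof (cases "\<forall>x::'x. x = 0")
  case True
  then show ?thesis by (intro ISS_of_trivial_state_space) auto
next
  case False
  then obtain z :: 'x where z: "z \<noteq> 0" by blast
  obtain V where "noncoercive_ISS_Lyapunov V \<phi>" using assms(4) by blast
  then obtain \<psi> \<alpha> \<sigma> where V: "continuous_on UNIV V" "\<And>x. 0 \<le> V x"
    and K: "class_Kinf \<psi>" "class_Kinf \<alpha>" "class_K \<sigma>"
    and V_le: "\<And>x. x \<noteq> 0 \<Longrightarrow> V x \<le> \<psi> (norm x)"
    and dini: "\<And>x u. u \<in> Linf_inputs \<Longrightarrow>
      dini_derivative V \<phi> x u \<le> ereal (- \<alpha> (norm x) + \<sigma> (linf_norm u))"
    unfolding noncoercive_ISS_Lyapunov_def by metis
  have \<psi>: "class_K \<psi>" using K by (simp add: class_Kinf_def)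
  \<comment> \<open>The bound is given away from 0 only; it passes to the limit along the ray
    through the nonzero point \<open>z\<close>, whence the separate case of the zero space.\<close>
  have "V 0 \<le> \<psi> 0"
  proof (rule tendsto_le)
    show "((\<lambda>h. V (h *\<^sub>R z)) \<longlongrightarrow> V 0) (at_right (0::real))"
    proof (rule continuous_on_tendsto_compose[OF V(1)])
      show "((\<lambda>h. h *\<^sub>R z) \<longlongrightarrow> 0) (at_right (0::real))"
        by (auto intro!: tendsto_eq_intros)
    qed auto
    have "continuous_on {0..} \<psi>" using \<psi> by (simp add: class_K_def)
    then show "((\<lambda>h. \<psi> (norm (h *\<^sub>R z))) \<longlongrightarrow> \<psi> 0) (at_right (0::real))"
    proof (rule continuous_on_tendsto_compose)
      show "((\<lambda>h. norm (h *\<^sub>R z)) \<longlongrightarrow> 0) (at_right (0::real))"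
        by (auto intro!: tendsto_eq_intros)
    qed auto
    show "eventually (\<lambda>h. V (h *\<^sub>R z) \<le> \<psi> (norm (h *\<^sub>R z))) (at_right 0)"
      using eventually_at_right_less[of "0::real"]
      by eventually_elim (use z in \<open>auto intro!: V_le simp del: norm_scaleR\<close>)
  qed auto
  then have "V x \<le> \<psi> (norm x)" for x using V_le[of x] by (cases "x = 0") auto
  then interpret lyapunov_control_system \<phi> V \<psi> \<alpha> \<sigma>
    using assms V K \<psi> dini by unfold_locales auto
  show ?thesis by (rule ISS)
qed

end
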